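(* Let $C_n$ denote the cycle on $n$ vertices. For every $n\ge 7$, $$D_t(C_n,x)=x\,D_t(C_{n-1},x)+x^2D_t(C_{n-3},x)+x^2D_t(C_{n-4},x).$$
   Context: A set $D\subseteq V(G)$ of a finite simple graph $G$ is a total dominating set if every vertex of $G$ is adjacent to some vertex of $D$. With $d_t(G,i)$ the number of total dominating sets of size $i$, the total domination polynomial is $D_t(G,x)=\sum_{i=1}^{|V(G)|}d_t(G,i)x^i$. *)

theory Defs
  imports
    "Graph_Theory.Pair_Digraph"
    "HOL-Computational_Algebra.Polynomial"
begin

text \<open>
  A finite simple graph is a \<^locale>\<open>pair_graph\<close>: a finite, symmetric, loop-free set of ordered
  pairs, so that \<open>u\<close> and \<open>v\<close> are adjacent iff \<open>(u, v)\<close> is an arc.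
\<close>

definition total_dominating :: "'a pair_pre_digraph \<Rightarrow> 'a set \<Rightarrow> bool" where
  "total_dominating G D \<longleftrightarrow> D \<subseteq> pverts G \<and> (\<forall>v\<in>pverts G. \<exists>u\<in>D. (u, v) \<in> parcs G)"

definition num_total_dominating :: "'a pair_pre_digraph \<Rightarrow> nat \<Rightarrow> nat" where
  "num_total_dominating G i = card {D. total_dominating G D \<and> card D = i}"

definition total_domination_poly :: "'a pair_pre_digraph \<Rightarrow> int poly" where
  "total_domination_poly G =
     (\<Sum>i = 1..card (pverts G). monom (int (num_total_dominating G i)) i)"

text \<open>The vertices are the residues modulo \<open>n\<close>; this is a simple cycle only for \<open>n \<ge> 3\<close>.\<close>

definition cycle_graph :: "nat \<Rightarrow> nat pair_pre_digraph" where
  "cycle_graph n =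
     \<lparr> pverts = {..<n},
       parcs = {(i, j). i < n \<and> j < n \<and> (j = Suc i mod n \<or> i = Suc j mod n)} \<rparr>"

lemma pair_graph_cycle_graph:
  assumes "n \<ge> 3"
  shows "pair_graph (cycle_graph n)"
proof -
  have no_loop: "Suc i mod n \<noteq> i" if "i < n" for i
    using that assms by (cases "Suc i = n") auto
  have fin: "finite (parcs (cycle_graph n))"
    by (rule finite_subset[of _ "{..<n} \<times> {..<n}"]) (auto simp: cycle_graph_def)
  show ?thesis
    by unfold_locales
      (use fin no_loop in \<open>auto simp: cycle_graph_def symmetric_def sym_def dest: no_loop no_loop[symmetric]\<close>)
qed

end

theory Submission
  imports Defs
begin

text \<open>
  A set \<open>D\<close> of residues modulo \<open>n\<close> is totally dominating iff of any two residues at distance two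
  at least one lies in \<open>D\<close>. Reading \<open>D\<close> around the cycle as a closed walk on the pairs of
  consecutive membership bits gives the polynomial as the trace of the \<open>n\<close>-th power of a
  \<open>4 \<times> 4\<close> transfer matrix. Its characteristic polynomial is
  \<open>t^4 - x t^3 - x^2 t - x^2\<close>, so the recurrence is the Cayley-Hamilton theorem.
\<close>

lemma Suc_mod_inject:
  assumes "Suc i mod n = Suc j mod n" "i < n" "j < n"
  shows "i = j"
  using assms by (auto simp: mod_Suc split: if_splits)

text \<open>The neighbours of \<open>Suc i mod n\<close> are \<open>i\<close> and
  \<open>(i + 2) mod n\<close>, so the condition at each vertex is indexed by its
  predecessor.\<close>

lemma total_dominating_cycle_graph_iff:
  "total_dominating (cycle_graph n) D \<longleftrightarrow>
     D \<subseteq> {..<n} \<and> (\<forall>i<n. i \<in> D \<or> (i + 2) mod n \<in> D)" (is "?L \<longleftrightarrow> ?R")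
proof
  assume L: ?L
  then have sub: "D \<subseteq> {..<n}" by (simp add: total_dominating_def cycle_graph_def)
  have "i \<in> D \<or> (i + 2) mod n \<in> D" if "i < n" for i
  proof -
    have "Suc i mod n < n" using that by simp
    with L obtain u where u: "u \<in> D"
      "Suc i mod n = Suc u mod n \<or> u = Suc (Suc i mod n) mod n"
      by (auto simp: total_dominating_def cycle_graph_def)
    from u(2) show ?thesis
    proof
      assume "Suc i mod n = Suc u mod n"
      then have "i = u" using Suc_mod_inject that u(1) sub by blast
      with u(1) show ?thesis by simp
    next
      assume "u = Suc (Suc i mod n) mod n"
      then show ?thesis using u(1) by (simp add: mod_Suc_eq)
    qed
  qed
  with sub show ?R by blast
next
  assume R: ?R
  have "\<exists>u\<in>D. u < n \<and> (v = Suc u mod n \<or> u = Suc v mod n)" if "v < n" for v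
  proof -
    \<comment> \<open>The predecessor of \<open>v\<close>; adding \<open>n\<close> first keeps the
      subtraction from truncating at \<open>v = 0\<close>.\<close>
    define i where "i = (v + n - 1) mod n"
    have i: "i < n" using that by (simp add: i_def)
    have v: "Suc i mod n = v" using that by (simp add: i_def mod_Suc_eq)
    have "(i + 2) mod n = Suc v mod n" by (simp add: v[symmetric] mod_Suc_eq)
    then have "i \<in> D \<or> Suc v mod n \<in> D" using R i by metis
    then show ?thesis using R v i by (metis lessThan_iff subsetD)
  qed
  then show ?L using R by (auto simp: total_dominating_def cycle_graph_def)
qed

text \<open>Group the sets by size. As there is a vertex to dominate, the empty set is excluded, so
  starting the sum at size 1 loses nothing.\<close>

lemma total_domination_poly_eq_sum:
  assumes "finite (pverts G)" "pverts G \<noteq> {}"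
  shows "total_domination_poly G = (\<Sum>D | total_dominating G D. monom 1 (card D))"
proof -
  let ?T = "{D. total_dominating G D}"
  have fin: "finite ?T"
    by (rule finite_subset[of _ "Pow (pverts G)"]) (auto simp: total_dominating_def assms)
  have range: "card ` ?T \<subseteq> {1..card (pverts G)}"
  proof clarify
    fix D assume D: "total_dominating G D"
    then have "D \<subseteq> pverts G" "D \<noteq> {}"
      using assms by (auto simp: total_dominating_def)
    then show "card D \<in> {1..card (pverts G)}"
      using assms by (auto simp: card_mono Suc_le_eq card_gt_0_iff intro: finite_subset)
  qed
  have "(\<Sum>D\<in>?T. monom (1::int) (card D))
      = (\<Sum>i = 1..card (pverts G). \<Sum>D | D \<in> ?T \<and> card D = i. monom 1 (card D))"
    by (intro sum.group[symmetric] fin range) simp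
  also have "\<dots> = total_domination_poly G"
    unfolding total_domination_poly_def num_total_dominating_def
    by (intro sum.cong refl) (simp add: of_nat_poly smult_monom poly_eq_iff)
  finally show ?thesis ..
qed

text \<open>The walks of length \<open>n\<close> from the pair \<open>(a, b)\<close> to the pair \<open>(c, d)\<close>.\<close>

definition walks :: "nat \<Rightarrow> bool \<Rightarrow> bool \<Rightarrow> bool \<Rightarrow> bool \<Rightarrow> nat set set" where
  "walks n a b c d =
     {E. E \<subseteq> {..<n + 2} \<and> (\<forall>i<n. i \<in> E \<or> i + 2 \<in> E) \<and>
         (0 \<in> E) = a \<and> (1 \<in> E) = b \<and> (n \<in> E) = c \<and> (n + 1 \<in> E) = d}"

text \<open>The last two positions carry no weight: in a closed walk they repeat the first two.\<close>

definition walk_poly :: "nat \<Rightarrow> bool \<Rightarrow> bool \<Rightarrow> bool \<Rightarrow> bool \<Rightarrow> int poly" where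
  "walk_poly n a b c d = (\<Sum>E\<in>walks n a b c d. monom 1 (card (E \<inter> {..<n})))"

lemma finite_walks: "finite (walks n a b c d)"
  by (rule finite_subset[of _ "Pow {..<n + 2}"]) (auto simp: walks_def)

text \<open>The trace formula: unrolling \<open>D\<close> to the positions \<open>n\<close> and
  \<open>n + 1\<close>, which repeat 0 and 1, turns dominating sets into closed walks. The bound on
  \<open>n\<close> makes 0 and 1 distinct residues.\<close>

lemma total_domination_poly_cycle_graph:
  assumes "n \<ge> 2"
  shows "total_domination_poly (cycle_graph n) = (\<Sum>(a, b)\<in>UNIV. walk_poly n a b a b)"
proof -
  let ?T = "{D. total_dominating (cycle_graph n) D}"
  let ?ends = "\<lambda>D. (0 \<in> D, 1 \<in> D) :: bool \<times> bool"
  let ?unroll = "\<lambda>D. {i. i < n + 2 \<and> i mod n \<in> D}"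
  have mods: "n mod n = 0" "Suc n mod n = 1"
    using assms by (auto simp: mod_Suc)
  have fin: "finite ?T"
    by (rule finite_subset[of _ "Pow {..<n}"]) (auto simp: total_dominating_cycle_graph_iff)
  \<comment> \<open>In a closed walk the last two bits equal the first two, so membership may be
    read modulo \<open>n\<close>.\<close>
  have restrict: "i mod n \<in> E \<inter> {..<n} \<longleftrightarrow> i \<in> E" if "E \<in> walks n a b a b" "i < n + 2" for E a b i
  proof -
    have "i < n \<or> i = n \<or> i = Suc n" using that(2) by linarith
    then show ?thesis using that(1) assms mods by (elim disjE) (auto simp: walks_def)
  qed
  have fibre: "(\<Sum>D | D \<in> ?T \<and> ?ends D = (a, b). monom 1 (card D)) = walk_poly n a b a b" for a b
    unfolding walk_poly_def
  proof (rule sum.reindex_bij_witness[where i = "\<lambda>E. E \<inter> {..<n}" and j = ?unroll])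
    fix D assume D: "D \<in> {D \<in> ?T. ?ends D = (a, b)}"
    then have sub: "D \<subseteq> {..<n}" by (simp add: total_dominating_cycle_graph_iff)
    then show inv: "?unroll D \<inter> {..<n} = D" by auto
    show "?unroll D \<in> walks n a b a b"
      using D assms mods by (auto simp: total_dominating_cycle_graph_iff walks_def)
    show "monom 1 (card (?unroll D \<inter> {..<n})) = monom (1::int) (card D)" by (simp only: inv)
  next
    fix E assume E: "E \<in> walks n a b a b"
    then show "?unroll (E \<inter> {..<n}) = E"
      using restrict[OF E] by (auto simp: walks_def)
    have "i \<in> E \<inter> {..<n} \<or> (i + 2) mod n \<in> E \<inter> {..<n}" if "i < n" for i
      using E restrict[OF E, of "i + 2"] that by (auto simp: walks_def)
    then show "E \<inter> {..<n} \<in> {D \<in> ?T. ?ends D = (a, b)}"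
      using E assms by (auto simp: total_dominating_cycle_graph_iff walks_def)
  qed
  have "total_domination_poly (cycle_graph n) = (\<Sum>D\<in>?T. monom 1 (card D))"
    using assms by (subst total_domination_poly_eq_sum) (auto simp: cycle_graph_def lessThan_empty_iff)
  also have "\<dots> = (\<Sum>p\<in>UNIV. \<Sum>D | D \<in> ?T \<and> ?ends D = p. monom 1 (card D))"
    by (intro sum.group[symmetric] fin) simp_all
  also have "\<dots> = (\<Sum>(a, b)\<in>UNIV. walk_poly n a b a b)"
  proof (rule sum.cong[OF refl])
    fix p :: "bool \<times> bool"
    show "(\<Sum>D | D \<in> ?T \<and> ?ends D = p. monom 1 (card D)) = (case p of (a, b) \<Rightarrow> walk_poly n a b a b)"
      by (cases p) (simp only: fibre prod.case)
  qed
  finally show ?thesis .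
qed

text \<open>The last step leads from the pair at \<open>n\<close>, \<open>n + 1\<close> to the pair
  at \<open>n + 1\<close>, \<open>n + 2\<close>; the only new constraint is the one at
  \<open>i = n\<close>.\<close>

lemma mem_walks_Suc_iff:
  "E \<in> walks (Suc n) a b c d \<longleftrightarrow>
     E - {n + 2} \<in> walks n a b (n \<in> E) c \<and> (n + 2 \<in> E) = d \<and> (n \<in> E \<or> d)"
proof -
  have "E \<subseteq> {..<Suc n + 2} \<longleftrightarrow> E - {n + 2} \<subseteq> {..<n + 2}"
    by (simp add: subset_iff) (metis less_Suc_eq)
  moreover have "(\<forall>i<Suc n. i \<in> E \<or> i + 2 \<in> E) \<longleftrightarrow>
      (\<forall>i<n. i \<in> E - {n + 2} \<or> i + 2 \<in> E - {n + 2}) \<and> (n \<in> E \<or> n + 2 \<in> E)"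
    by (simp add: All_less_Suc) blast
  ultimately show ?thesis
    unfolding walks_def mem_Collect_eq by simp blast
qed

text \<open>One multiplication by the transfer matrix. Summing over the bit \<open>e\<close> at
  position \<open>n\<close>, which now starts to carry weight, the step from \<open>(e, c)\<close>
  to \<open>(c, d)\<close> contributes \<open>x\<close> if \<open>e\<close> holds, 1 if only
  \<open>d\<close> does, and 0 if neither does.\<close>

lemma walk_poly_Suc:
  "walk_poly (Suc n) a b c d =
     [:0, 1:] * walk_poly n a b True c + (if d then walk_poly n a b False c else 0)"
proof -
  let ?x = "[:0, 1:] :: int poly"
  have part: "(\<Sum>E | E \<in> walks (Suc n) a b c d \<and> (n \<in> E) = e. monom (1::int) (card (E \<inter> {..<Suc n})))
      = (if e then ?x else 1) * walk_poly n a b e c" if "e \<or> d" for e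
    unfolding walk_poly_def sum_distrib_left
  proof (rule sum.reindex_bij_witness[where
        i = "\<lambda>E. if d then insert (n + 2) E else E" and j = "\<lambda>E. E - {n + 2}"])
    fix E assume E: "E \<in> {E \<in> walks (Suc n) a b c d. (n \<in> E) = e}"
    show "(if d then insert (n + 2) (E - {n + 2}) else E - {n + 2}) = E"
      using E by (auto simp: mem_walks_Suc_iff)
    have e: "e = (n \<in> E)" using E by simp
    show "E - {n + 2} \<in> walks n a b e c"
      using E unfolding e by (simp add: mem_walks_Suc_iff)
    have "(E - {n + 2}) \<inter> {..<n} = E \<inter> {..<n}" by auto
    moreover have "E \<inter> {..<Suc n} = (if e then insert n (E \<inter> {..<n}) else E \<inter> {..<n})"
      using E by (auto simp: less_Suc_eq)
    ultimately show "(if e then ?x else 1) * monom 1 (card ((E - {n + 2}) \<inter> {..<n}))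
        = monom 1 (card (E \<inter> {..<Suc n}))"
      by (simp add: monom_Suc)
  next
    fix E assume E: "E \<in> walks n a b e c"
    then have notin: "n + 2 \<notin> E" and e: "(n \<in> E) = e" by (auto simp: walks_def)
    then show inv: "(if d then insert (n + 2) E else E) - {n + 2} = E" by auto
    show "(if d then insert (n + 2) E else E) \<in> {E \<in> walks (Suc n) a b c d. (n \<in> E) = e}"
      unfolding mem_Collect_eq mem_walks_Suc_iff inv using E that notin e by auto
  qed
  have zero: "(\<Sum>E | E \<in> walks (Suc n) a b c d \<and> (n \<in> E) = False.
      monom (1::int) (card (E \<inter> {..<Suc n}))) = 0" if "\<not> d"
    using that by (intro sum.neutral) (auto simp: mem_walks_Suc_iff)
  have "walk_poly (Suc n) a b c d = (\<Sum>e\<in>UNIV. \<Sum>E | E \<in> walks (Suc n) a b c d \<and> (n \<in> E) = e.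
      monom 1 (card (E \<inter> {..<Suc n})))"
    unfolding walk_poly_def by (intro sum.group[symmetric] finite_walks) simp_all
  also have "\<dots> = ?x * walk_poly n a b True c + (if d then walk_poly n a b False c else 0)"
    using part[of True] part[of False] zero by (cases d) (simp_all add: UNIV_bool del: mult_pCons_left)
  finally show ?thesis .
qed

text \<open>Cayley-Hamilton, entry by entry: unfolding every term down to length \<open>n\<close>
  leaves an identity between combinations of the four values \<open>walk_poly n a b _ _\<close>,
  checked for each end \<open>(c, d)\<close>.\<close>

lemma walk_poly_recurrence:
  "walk_poly (n + 4) a b c d =
     [:0, 1:] * walk_poly (n + 3) a b c d
   + [:0, 1:]\<^sup>2 * walk_poly (n + 1) a b c d
   + [:0, 1:]\<^sup>2 * walk_poly n a b c d"
proof -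
  \<comment> \<open>Keeping the indeterminate opaque stops \<open>simp\<close> from rewriting
    products with it into \<open>pCons\<close> form.\<close>
  define x where "x = [:0, 1::int:]"
  show ?thesis
    unfolding x_def[symmetric]
    by (cases c; cases d; simp add: numeral_eq_Suc walk_poly_Suc[folded x_def];
        simp add: power2_eq_square algebra_simps)
qed

theorem theorem4:
  fixes n :: nat
  assumes "n \<ge> 7"
  shows "total_domination_poly (cycle_graph n) =
           [:0, 1:] * total_domination_poly (cycle_graph (n - 1))
         + [:0, 1:]\<^sup>2 * total_domination_poly (cycle_graph (n - 3))
         + [:0, 1:]\<^sup>2 * total_domination_poly (cycle_graph (n - 4))"
proof -
  obtain m where m: "n = m + 4" "m \<ge> 2"
    using assms by (intro that[of "n - 4"]) auto
  then have idx: "n - 1 = m + 3" "n - 3 = m + 1" "n - 4 = m" by auto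
  have poly: "total_domination_poly (cycle_graph (m + k)) = (\<Sum>(a, b)\<in>UNIV. walk_poly (m + k) a b a b)"
    for k using m by (intro total_domination_poly_cycle_graph) simp
  \<comment> \<open>The coefficients are the same for all diagonal entries, so the recurrence passes
    to the trace.\<close>
  show ?thesis
    unfolding idx unfolding m(1) poly poly[of 0, unfolded add_0_right] walk_poly_recurrence
    by (simp only: sum_distrib_left sum.distrib case_prod_unfold)
qed

end
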